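(* (a) An abnormal optimal path for Problem (Pc) over the interval $[t_{i-1},t_i]$ in stage $i$, $i=1,\dots,N$, is either of type $CC$ or of type $C$, with respective lengths of at most $2\pi/a$ and $\pi/a$. (b) An abnormal optimal path for Problem (Pc) is of type $CC\cdots C$, with at least $N$ and at most $2N$ copies of $C$ concatenated, resulting in the length of the path to be at most $2N\pi/a$.
   Context: Fix an integer $N\ge1$, a real $a>0$, points $p_i=(x_i,y_i)\in\mathbb{R}^2$, $i=0,\dots,N$, with $p_{i-1}\neq p_i$, and angles $\theta_0,\theta_f\in\mathbb{R}$. Problem (Pc): minimize $t_N$ over node times $0=t_0<t_1<\dots<t_N$ (free), measurable controls $u$ with $|u(t)|\le a$ a.e., and states $x,y,\theta$ with $\dot x=\cos\theta$, $\dot y=\sin\theta$, $\dot\theta=u$ on $[0,t_N]$, $(x(t_i),y(t_i))=p_i$ for $i=0,\dots,N$, $\theta(0)=\theta_0$, $\theta(t_N)=\theta_f$. Stage $i$ is the part of the path over $[t_{i-1},t_i]$. Necessary conditions (maximum principle): for an optimal solution there exist a number $\lambda_0\ge0$, real constants $\overline\lambda_1^i,\overline\lambda_2^i$ ($i=1,\dots,N$), and a continuous function $\lambda_3:[0,t_N]\to\mathbb{R}$, Lipschitz on each stage, such that for every $i=1,\dots,N$: (1) $(\lambda_0,\overline\lambda_1^i,\overline\lambda_2^i,\lambda_3(t))\neq 0$ for all $t\in[t_{i-1},t_i]$; (2) $\dot\lambda_3(t)=\overline\lambda_1^i\sin\theta(t)-\overline\lambda_2^i\cos\theta(t)$ on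 $[t_{i-1},t_i]$; (3) for a.e. $t\in[t_{i-1},t_i)$, $u(t)=a$ if $\lambda_3(t)<0$, $u(t)=-a$ if $\lambda_3(t)>0$ ($u(t)$ is undetermined in $[-a,a]$ if $\lambda_3(t)=0$); (4) $\lambda_0+\overline\lambda_1^i\cos\theta(t)+\overline\lambda_2^i\sin\theta(t)+\lambda_3(t)u(t)=0$ on $[t_{i-1},t_i)$. An optimal path is abnormal if $\lambda_0=0$ in these conditions (the number $\lambda_0$ is the same in all stages). Types: $C$ is a circular arc of positive length with $u\equiv a$ or $u\equiv-a$; adjacent $C$'s within a stage have opposite signs of $u$. In (b) the copies of $C$ are counted stage by stage (an arc with constant $u$ passing through a node is counted as one copy in each of the stages it meets). *)

theory Defs
  imports "HOL-Analysis.Analysis"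
begin

text \<open>A candidate for the interpolation problem. Only the nodes with index at most \<open>N\<close> and the
  values of the functions on \<open>[0, t\<^sub>N]\<close> matter.\<close>

record trajectory =
  node :: "nat \<Rightarrow> real"
  ctrl :: "real \<Rightarrow> real"
  xpos :: "real \<Rightarrow> real"
  ypos :: "real \<Rightarrow> real"
  head :: "real \<Rightarrow> real"

text \<open>The control is only measurable, so the equation for the heading angle is understood in the
  sense of Caratheodory, that is, in integrated form. As the heading angle is then continuous, the
  position is continuously differentiable and its two equations hold everywhere (one-sidedly at
  the end points). The heading angle is a real number, not a residue modulo \<open>2\<pi>\<close>.\<close>

definition feasible ::
  "nat \<Rightarrow> real \<Rightarrow> (nat \<Rightarrow> real \<times> real) \<Rightarrow> real \<Rightarrow> real \<Rightarrow> trajectory \<Rightarrow> bool" where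
  "feasible N a p \<theta>0 \<theta>f z \<longleftrightarrow>
     (let T = node z N in
       node z 0 = 0 \<and>
       (\<forall>i\<in>{1..N}. node z (i - 1) < node z i) \<and>
       ctrl z \<in> borel_measurable (lebesgue_on {0..T}) \<and>
       (AE \<tau> in lebesgue_on {0..T}. \<bar>ctrl z \<tau>\<bar> \<le> a) \<and>
       (\<forall>\<tau>\<in>{0..T}. (xpos z has_real_derivative cos (head z \<tau>)) (at \<tau> within {0..T})) \<and>
       (\<forall>\<tau>\<in>{0..T}. (ypos z has_real_derivative sin (head z \<tau>)) (at \<tau> within {0..T})) \<and>
       (\<forall>\<tau>\<in>{0..T}. (ctrl z has_integral (head z \<tau> - head z 0)) {0..\<tau>}) \<and>
       (\<forall>i\<in>{0..N}. (xpos z (node z i), ypos z (node z i)) = p i) \<and>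
       head z 0 = \<theta>0 \<and> head z T = \<theta>f)"

definition optimal ::
  "nat \<Rightarrow> real \<Rightarrow> (nat \<Rightarrow> real \<times> real) \<Rightarrow> real \<Rightarrow> real \<Rightarrow> trajectory \<Rightarrow> bool" where
  "optimal N a p \<theta>0 \<theta>f z \<longleftrightarrow>
     feasible N a p \<theta>0 \<theta>f z \<and>
     (\<forall>z'. feasible N a p \<theta>0 \<theta>f z' \<longrightarrow> node z N \<le> node z' N)"

text \<open>The conditions of the maximum principle. The control is an equivalence class of functions
  modulo null sets, so the last condition, in which it occurs, is required almost everywhere;
  asking for it at every point would make it depend on the chosen representative.\<close>

definition multipliers ::
  "nat \<Rightarrow> real \<Rightarrow> trajectory \<Rightarrow> real \<Rightarrow> (nat \<Rightarrow> real) \<Rightarrow> (nat \<Rightarrow> real) \<Rightarrow> (real \<Rightarrow> real) \<Rightarrow> bool" where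
  "multipliers N a z l0 l1 l2 l3 \<longleftrightarrow>
     l0 \<ge> 0 \<and>
     continuous_on {0..node z N} l3 \<and>
     (\<forall>i\<in>{1..N}.
        (\<exists>L. L-lipschitz_on {node z (i - 1)..node z i} l3) \<and>
        (\<forall>\<tau>\<in>{node z (i - 1)..node z i}. (l0, l1 i, l2 i, l3 \<tau>) \<noteq> (0, 0, 0, 0)) \<and>
        (\<forall>\<tau>\<in>{node z (i - 1)..node z i}.
           (l3 has_real_derivative l1 i * sin (head z \<tau>) - l2 i * cos (head z \<tau>))
             (at \<tau> within {node z (i - 1)..node z i})) \<and>
        (AE \<tau> in lebesgue_on {node z (i - 1)..<node z i}.
           (l3 \<tau> < 0 \<longrightarrow> ctrl z \<tau> = a) \<and> (l3 \<tau> > 0 \<longrightarrow> ctrl z \<tau> = - a)) \<and>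
        (AE \<tau> in lebesgue_on {node z (i - 1)..<node z i}.
           l0 + l1 i * cos (head z \<tau>) + l2 i * sin (head z \<tau>) + l3 \<tau> * ctrl z \<tau> = 0))"

definition abnormal :: "nat \<Rightarrow> real \<Rightarrow> trajectory \<Rightarrow> bool" where
  "abnormal N a z \<longleftrightarrow> (\<exists>l1 l2 l3. multipliers N a z 0 l1 l2 l3)"

definition path_length :: "trajectory \<Rightarrow> real \<Rightarrow> real \<Rightarrow> real" where
  "path_length z s e =
     integral {s..e} (\<lambda>\<tau>. norm (vector_derivative (\<lambda>r. (xpos z r, ypos z r)) (at \<tau> within {s..e})))"

text \<open>\<open>C_type a z s e k\<close>: over \<open>[s, e]\<close> the path is of type \<open>CC\<dots>C\<close> with \<open>k\<close> copies of \<open>C\<close>.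
  The arcs are those between consecutive break points \<open>b 0 < \<dots> < b k\<close>, and \<open>c j\<close> is the constant
  value of the control on the arc from \<open>b j\<close> to \<open>b (Suc j)\<close>. Because adjacent arcs turn in opposite
  directions, \<open>k\<close> is determined by the path.\<close>

definition C_type :: "real \<Rightarrow> trajectory \<Rightarrow> real \<Rightarrow> real \<Rightarrow> nat \<Rightarrow> bool" where
  "C_type a z s e k \<longleftrightarrow>
     (\<exists>(b :: nat \<Rightarrow> real) (c :: nat \<Rightarrow> real).
        b 0 = s \<and> b k = e \<and>
        (\<forall>j<k. b j < b (Suc j) \<and> (c j = a \<or> c j = - a) \<and>
               (AE \<tau> in lebesgue_on {b j..b (Suc j)}. ctrl z \<tau> = c j)) \<and>
        (\<forall>j. Suc j < k \<longrightarrow> c (Suc j) = - c j))"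

end

theory Submission
  imports Defs
begin

text \<open>If \<open>\<lambda>\<^sub>0 = 0\<close>, write \<open>A = l\<^sub>1 cos \<theta> + l\<^sub>2 sin \<theta>\<close> and \<open>B = l\<^sub>1 sin \<theta> - l\<^sub>2 cos \<theta>\<close> in a fixed stage. The
  Hamiltonian condition and the bang-bang law give \<open>A = a |\<lambda>\<^sub>3|\<close>, the adjoint equation is
  \<open>\<lambda>\<^sub>3' = B\<close>, and \<open>A\<^sup>2 + B\<^sup>2 = l\<^sub>1\<^sup>2 + l\<^sub>2\<^sup>2 > 0\<close>. Hence \<open>\<lambda>\<^sub>3\<close> changes sign at each of its zeros, and
  between zeros the path is an arc along which \<open>(A, B)\<close> rotates with \<open>A > 0\<close>, so that it turns by at
  most \<open>\<pi>\<close>, and by exactly \<open>\<pi>\<close> if both ends are zeros. Two zeros inside a stage would therefore give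
  a half-circle preceded and followed by arcs of opposite orientation. Such a path is not optimal:
  for small \<open>\<epsilon>\<close> and \<open>a = 1\<close>, the piece \<open>L\<^sub>\<epsilon> R\<^sub>\<pi> L\<^sub>\<epsilon>\<close> has the same end points and end headings as two
  arcs \<open>R\<close> of length \<open>\<pi>/2 - \<epsilon>\<close> joined by a segment of length \<open>4 (1 - cos \<epsilon>)\<close>, and
  \<open>1 - cos \<epsilon> < \<epsilon>\<close>. So every stage has at most one switch and at most two arcs.\<close>

subsection \<open>Concatenating steered paths\<close>

text \<open>Completeness of Lebesgue measure makes the exceptional set itself negligible, without a
  separate measurability check.\<close>

lemma AE_lebesgue_on_iff_negligible:
  fixes S :: "'a::euclidean_space set"
  assumes "S \<in> sets lebesgue"
  shows "(AE x in lebesgue_on S. P x) \<longleftrightarrow> negligible {x \<in> S. \<not> P x}"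
proof -
  have "(AE x in lebesgue_on S. P x) \<longleftrightarrow> (AE x in lebesgue. x \<in> S \<longrightarrow> P x)"
    using assms by (subst AE_restrict_space_iff) auto
  also have "\<dots> \<longleftrightarrow> (\<exists>N. negligible N \<and> {x \<in> S. \<not> P x} \<subseteq> N)"
    by (auto simp: eventually_ae_filter negligible_iff_null_sets)
  also have "\<dots> \<longleftrightarrow> negligible {x \<in> S. \<not> P x}"
    by (meson negligible_subset subset_refl)
  finally show ?thesis .
qed

text \<open>The pointwise bound on the control keeps null sets out of cutting, shifting and gluing.
  Positions are left out because integrating the heading recovers them.\<close>

definition steers :: "real \<Rightarrow> (real \<Rightarrow> real) \<Rightarrow> (real \<Rightarrow> real) \<Rightarrow> real \<Rightarrow> real \<Rightarrow> bool" where
  "steers a u h s e \<longleftrightarrow> s \<le> e \<and>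
     (\<forall>t\<in>{s..e}. \<bar>u t\<bar> \<le> a \<and> (u has_integral (h t - h s)) {s..t})"

definition cat :: "real \<Rightarrow> (real \<Rightarrow> 'a) \<Rightarrow> (real \<Rightarrow> 'a) \<Rightarrow> real \<Rightarrow> 'a" where
  "cat m f g t = (if t < m then f t else g t)"

lemma steers_continuous_on:
  assumes "steers a u h s e"
  shows "continuous_on {s..e} h"
proof -
  have "u integrable_on {s..e}"
    using assms unfolding steers_def by (meson atLeastAtMost_iff has_integral_integrable order_refl)
  then have "continuous_on {s..e} (\<lambda>t. h s + integral {s..t} u)"
    by (intro continuous_intros indefinite_integral_continuous_1)
  moreover have "h s + integral {s..t} u = h t" if "t \<in> {s..e}" for t
    using assms that unfolding steers_def by (metis add_diff_cancel_left' diff_add_cancel add.commute integral_unique)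
  ultimately show ?thesis
    by (rule continuous_on_eq)
qed

lemma has_integral_increment:
  fixes u h :: "real \<Rightarrow> real"
  assumes "\<And>t. t \<in> {s..e} \<Longrightarrow> (u has_integral (h t - h s)) {s..t}" "s \<le> r" "r \<le> t" "t \<le> e"
  shows "(u has_integral (h t - h r)) {r..t}"
proof -
  have r: "(u has_integral (h r - h s)) {s..r}" and t: "(u has_integral (h t - h s)) {s..t}"
    using assms by auto
  have "u integrable_on {r..t}"
    by (rule integrable_on_subinterval[OF has_integral_integrable[OF t]]) (use assms in auto)
  moreover have "integral {s..r} u + integral {r..t} u = integral {s..t} u"
    using assms(2,3) has_integral_integrable[OF t]
    by (intro Henstock_Kurzweil_Integration.integral_combine) auto
  ultimately show ?thesis
    using r t by (simp add: has_integral_integrable_integral)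
qed

lemma steers_subinterval:
  assumes "steers a u h s e" "s \<le> r" "r \<le> q" "q \<le> e"
  shows "steers a u h r q"
  using assms has_integral_increment[of s e u h r] by (auto simp: steers_def)

lemma has_integral_cat:
  fixes f g :: "real \<Rightarrow> 'a::banach"
  assumes "(f has_integral i) {s..m}" "(g has_integral j) {m..e}" "s \<le> m" "m \<le> e"
  shows "(cat m f g has_integral (i + j)) {s..e}"
proof (rule has_integral_combine[OF assms(3,4)])
  show "(cat m f g has_integral i) {s..m}"
    \<comment> \<open>At \<open>m\<close> itself \<open>cat\<close> already takes the value of
      \<open>g\<close>; this affects a single point.\<close>
    by (rule has_integral_spike[OF _ _ assms(1), where S = "{m}"]) (auto simp: cat_def)
  show "(cat m f g has_integral j) {m..e}"
    by (rule has_integral_eq[OF _ assms(2)]) (auto simp: cat_def)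
qed

lemma steers_cat:
  assumes "steers a u h s m" "steers a v k m e" "h m = k m"
  shows "steers a (cat m u v) (cat m h k) s e"
  unfolding steers_def
proof (intro conjI ballI)
  fix t assume t: "t \<in> {s..e}"
  show "\<bar>cat m u v t\<bar> \<le> a"
    using assms t by (auto simp: steers_def cat_def)
  have s: "cat m h k s = h s"
    using assms by (auto simp: steers_def cat_def not_less)
  show "(cat m u v has_integral (cat m h k t - cat m h k s)) {s..t}"
  proof (cases "t < m")
    case True
    then have "(u has_integral (h t - h s)) {s..t}"
      using assms t by (auto simp: steers_def)
    then have "(cat m u v has_integral (h t - h s)) {s..t}"
      by (rule has_integral_eq[rotated]) (use True in \<open>auto simp: cat_def\<close>)
    then show ?thesis
      unfolding s using True by (simp add: cat_def)
  next
    case False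
    have "(u has_integral (h m - h s)) {s..m}" "(v has_integral (k t - k m)) {m..t}"
      using assms(1,2) t False by (auto simp: steers_def)
    then have "(cat m u v has_integral ((h m - h s) + (k t - k m))) {s..t}"
      using assms(1) False by (intro has_integral_cat) (auto simp: steers_def)
    then show ?thesis
      unfolding s using False assms(3) by (simp add: cat_def)
  qed
qed (use assms in \<open>auto simp: steers_def\<close>)

lemma steers_arc:
  assumes "\<bar>c\<bar> \<le> a" "s \<le> e"
  shows "steers a (\<lambda>_. c) (\<lambda>t. \<theta> + c * (t - s)) s e"
  unfolding steers_def
proof (intro conjI ballI)
  fix t assume "t \<in> {s..e}"
  then show "((\<lambda>_. c) has_integral (\<theta> + c * (t - s) - (\<theta> + c * (s - s)))) {s..t}"
    using has_integral_const_real[of c s t] by (simp add: mult.commute)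
qed (use assms in auto)

lemma steers_shift:
  assumes "steers a u h s e"
  shows "steers a (\<lambda>t. u (d + t)) (\<lambda>t. h (d + t)) (s - d) (e - d)"
  unfolding steers_def
proof (intro conjI ballI)
  fix t assume t: "t \<in> {s - d..e - d}"
  then show "\<bar>u (d + t)\<bar> \<le> a"
    using assms by (auto simp: steers_def)
  have "(u has_integral (h (d + t) - h s)) {(s - d) + d..t + d}"
    using assms t by (auto simp: steers_def add.commute)
  then show "((\<lambda>t. u (d + t)) has_integral (h (d + t) - h (d + (s - d)))) {s - d..t}"
    using has_integral_shift_Icc_real[of u d _ "s - d" t] by (simp add: o_def)
qed (use assms in \<open>auto simp: steers_def\<close>)

text \<open>The heading is assumed affine only on the interval, so that the lemma serves both the
  explicit arcs of a shortcut and pieces of the given path.\<close>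

lemma has_integral_cos_arc:
  fixes c :: real
  assumes "c \<noteq> 0" "s \<le> e" and h: "\<And>t. t \<in> {s..e} \<Longrightarrow> h t = h s + c * (t - s)"
  shows "((\<lambda>t. cos (h t + \<beta>)) has_integral (sin (h e + \<beta>) - sin (h s + \<beta>)) / c) {s..e}"
proof -
  have "((\<lambda>t. cos (h s + c * (t - s) + \<beta>)) has_integral
          (sin (h s + c * (e - s) + \<beta>) / c - sin (h s + c * (s - s) + \<beta>) / c)) {s..e}"
    using assms(1,2)
    by (intro fundamental_theorem_of_calculus)
       (auto intro!: derivative_eq_intros simp flip: has_real_derivative_iff_has_vector_derivative)
  also have "h s + c * (e - s) = h e"
    using h[of e] assms(2) by simp
  also have "sin (h e + \<beta>) / c - sin (h s + c * (s - s) + \<beta>) / c = (sin (h e + \<beta>) - sin (h s + \<beta>)) / c"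
    by (simp add: diff_divide_distrib)
  finally show ?thesis
    by (rule has_integral_eq[rotated]) (simp only: h)
qed

lemma integral_cos_cat:
  fixes h k :: "real \<Rightarrow> real"
  assumes "continuous_on {s..m} h" "continuous_on {m..e} k" "h m = k m" "s \<le> m" "m \<le> e"
  shows "integral {s..e} (\<lambda>t. cos (cat m h k t + \<beta>)) =
           integral {s..m} (\<lambda>t. cos (h t + \<beta>)) + integral {m..e} (\<lambda>t. cos (k t + \<beta>))"
proof -
  have "((\<lambda>t. cos (h t + \<beta>)) has_integral integral {s..m} (\<lambda>t. cos (h t + \<beta>))) {s..m}"
       "((\<lambda>t. cos (k t + \<beta>)) has_integral integral {m..e} (\<lambda>t. cos (k t + \<beta>))) {m..e}"
    by (intro integrable_integral integrable_continuous_real continuous_intros assms(1,2))+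
  from has_integral_cat[OF this assms(4,5)] show ?thesis
    by (intro integral_unique, rule has_integral_eq[rotated]) (auto simp: cat_def)
qed

section \<open>Feasible trajectories and the effect of a shortcut\<close>

lemma feasible_has_integral_cos:
  assumes "feasible N a p \<theta>0 \<theta>f z" "0 \<le> r" "r \<le> q" "q \<le> node z N"
  shows "((\<lambda>t. cos (head z t)) has_integral (xpos z q - xpos z r)) {r..q}"
    and "((\<lambda>t. sin (head z t)) has_integral (ypos z q - ypos z r)) {r..q}"
proof -
  have "(xpos z has_real_derivative cos (head z t)) (at t within {r..q})"
       "(ypos z has_real_derivative sin (head z t)) (at t within {r..q})" if "t \<in> {r..q}" for t
    using assms that unfolding feasible_def Let_def
    by (auto intro!: DERIV_subset[where s = "{0..node z N}" and t = "{r..q}"])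
  then show "((\<lambda>t. cos (head z t)) has_integral (xpos z q - xpos z r)) {r..q}"
    and "((\<lambda>t. sin (head z t)) has_integral (ypos z q - ypos z r)) {r..q}"
    using assms(3)
    by (auto intro!: fundamental_theorem_of_calculus simp flip: has_real_derivative_iff_has_vector_derivative)
qed

lemma feasible_node_mono:
  assumes "feasible N a p \<theta>0 \<theta>f z" "i \<le> j" "j \<le> N"
  shows "node z i \<le> node z j"
  using assms(2,3)
proof (induction j rule: dec_induct)
  case (step n)
  have "node z (Suc n - 1) < node z (Suc n)"
    using assms(1) step unfolding feasible_def Let_def by (metis atLeastAtMost_iff le_add1 plus_1_eq_Suc)
  then show ?case
    using step by simp
qed auto

lemma feasible_node_nonneg:
  assumes "feasible N a p \<theta>0 \<theta>f z" "j \<le> N"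
  shows "0 \<le> node z j"
  using feasible_node_mono[OF assms(1), of 0 j] assms by (simp add: feasible_def Let_def)

text \<open>\<open>steers\<close> bounds the control at every point, whereas feasibility does so almost everywhere;
  clipping changes the control only on a null set.\<close>

lemma feasible_steers:
  assumes "feasible N a p \<theta>0 \<theta>f z" "0 \<le> a"
  shows "steers a (\<lambda>t. max (- a) (min a (ctrl z t))) (head z) 0 (node z N)"
  unfolding steers_def
proof (intro conjI ballI)
  fix t assume t: "t \<in> {0..node z N}"
  have "AE \<tau> in lebesgue_on {0..node z N}. \<bar>ctrl z \<tau>\<bar> \<le> a"
    using assms by (simp add: feasible_def Let_def)
  then have n: "negligible {\<tau> \<in> {0..node z N}. \<not> \<bar>ctrl z \<tau>\<bar> \<le> a}"
    by (subst (asm) AE_lebesgue_on_iff_negligible) auto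
  have "(ctrl z has_integral (head z t - head z 0)) {0..t}"
    using assms(1) t unfolding feasible_def Let_def by blast
  then show "((\<lambda>t. max (- a) (min a (ctrl z t))) has_integral (head z t - head z 0)) {0..t}"
    by (rule has_integral_spike[OF n, rotated]) (use t in auto)
qed (use assms feasible_node_nonneg[OF assms(1), of N] in auto)

text \<open>The shift \<open>\<beta>\<close> treats both coordinates of the displacement at once: \<open>\<beta> = 0\<close> gives the first one,
  and \<open>\<beta> = -\<pi>/2\<close> the second.\<close>

lemma shortcut_contradicts_optimal:
  assumes opt: "optimal N a p \<theta>0 \<theta>f z" and a: "0 \<le> a" and i: "i \<in> {1..N}"
    and s: "node z (i - 1) \<le> s" "s < m" "m < e" "e \<le> node z i"
    and k: "steers a v k s m" "k s = head z s" "k m = head z e"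
    and disp: "\<And>\<beta>. integral {s..m} (\<lambda>t. cos (k t + \<beta>)) = integral {s..e} (\<lambda>t. cos (head z t + \<beta>))"
  shows False
proof -
  define T where "T = node z N"
  define d where "d = e - m"
  define u where "u = (\<lambda>t. max (- a) (min a (ctrl z t)))"
  \<comment> \<open>The new path follows the old one up to \<open>s\<close>, takes the shortcut on
    \<open>[s, m]\<close>, and then repeats the old path from \<open>e\<close> on, earlier by
    \<open>d\<close>. Hence exactly the nodes from index \<open>i\<close> on move, all by
    \<open>d\<close>.\<close>
  define H where "H = cat s (head z) (cat m k (\<lambda>t. head z (d + t)))"
  define U where "U = cat s u (cat m v (\<lambda>t. u (d + t)))"
  define z' where "z' = \<lparr>node = (\<lambda>j. if j < i then node z j else node z j - d), ctrl = U,
     xpos = (\<lambda>t. xpos z 0 + integral {0..t} (\<lambda>r. cos (H r))),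
     ypos = (\<lambda>t. ypos z 0 + integral {0..t} (\<lambda>r. sin (H r))), head = H\<rparr>"
  have fz: "feasible N a p \<theta>0 \<theta>f z"
    using opt by (simp add: optimal_def)
  note mono = feasible_node_mono[OF fz]
  have n0: "node z 0 = 0"
    using fz by (simp add: feasible_def Let_def)
  have iT: "node z i \<le> T" and im: "0 \<le> node z (i - 1)"
    using i mono[of i N] feasible_node_nonneg[OF fz, of "i - 1"] by (auto simp: T_def)
  have "0 < d"
    using s by (simp add: d_def)
  have Td: "e - d = m"
    by (simp add: d_def)
  have z: "steers a u (head z) 0 T"
    unfolding u_def T_def by (rule feasible_steers[OF fz a])
  have zd: "steers a (\<lambda>t. u (d + t)) (\<lambda>t. head z (d + t)) m (T - d)"
    using steers_shift[OF steers_subinterval[OF z, of e T], of d] s im iT by (simp add: Td)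
  have z1: "steers a (cat m v (\<lambda>t. u (d + t))) (cat m k (\<lambda>t. head z (d + t))) s (T - d)"
    by (rule steers_cat[OF k(1) zd]) (simp add: k d_def)
  have z0: "steers a u (head z) 0 s"
    using steers_subinterval[OF z, of 0 s] s im iT by simp
  have UH: "steers a U H 0 (T - d)"
    unfolding U_def H_def using s by (intro steers_cat[OF z0 z1]) (simp add: cat_def k)
  have contH: "continuous_on {0..T - d} H"
    by (rule steers_continuous_on[OF UH])
  \<comment> \<open>At \<open>t = s\<close> the second piece is already in force;
    \<open>k s = head z s\<close> covers this point.\<close>
  have before: "H t = head z t" if "t \<le> s" for t
    using that s k by (auto simp: H_def cat_def)
  have H0: "H 0 = head z 0" and HT: "H (T - d) = head z T"
    using s im iT before by (auto simp: H_def cat_def d_def)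
  \<comment> \<open>Beyond the shortcut the new path is at time \<open>t - d\<close> where the old
    one is at time \<open>t\<close>: the pieces before \<open>s\<close> and after \<open>e\<close>
    are common, and the middle ones agree by \<open>disp\<close>.\<close>
  have disp': "integral {0..t - d} (\<lambda>r. cos (H r + \<beta>)) = integral {0..t} (\<lambda>r. cos (head z r + \<beta>))"
    if t: "e \<le> t" "t \<le> T" for t \<beta>
  proof -
    have c: "continuous_on {0..t} (head z)"
      using steers_continuous_on[OF z] t by (auto elim: continuous_on_subset)
    have cd: "continuous_on {m..t - d} (\<lambda>t. head z (d + t))"
      using steers_continuous_on[OF zd] t by (auto elim: continuous_on_subset)
    have c1: "continuous_on {s..t - d} (cat m k (\<lambda>t. head z (d + t)))"
      using steers_continuous_on[OF z1] t by (auto elim: continuous_on_subset)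
    have int: "(\<lambda>r. cos (head z r + \<beta>)) integrable_on {0..t}"
      by (intro integrable_continuous_real continuous_intros c)
    have "integral {0..t - d} (\<lambda>r. cos (H r + \<beta>)) = integral {0..s} (\<lambda>r. cos (head z r + \<beta>)) +
            (integral {s..m} (\<lambda>r. cos (k r + \<beta>)) +
             integral {m..t - d} (\<lambda>r. cos (head z (d + r) + \<beta>)))"
      unfolding H_def using s k t im
      by (subst integral_cos_cat[OF steers_continuous_on[OF z0] c1],
          simp_all add: cat_def[of m k _ s] d_def)
         (subst integral_cos_cat[OF steers_continuous_on[OF k(1)] cd[unfolded d_def]], simp_all)
    also have "integral {m..t - d} (\<lambda>r. cos (head z (d + r) + \<beta>)) =
                 integral {m + d..(t - d) + d} (\<lambda>r. cos (head z r + \<beta>))"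
      using integral_shift_Icc_real[of m "t - d" "\<lambda>r. cos (head z r + \<beta>)" d] by (simp add: o_def)
    also have "\<dots> = integral {e..t} (\<lambda>r. cos (head z r + \<beta>))"
      by (simp add: d_def)
    also have "integral {s..m} (\<lambda>r. cos (k r + \<beta>)) = integral {s..e} (\<lambda>r. cos (head z r + \<beta>))"
      by (rule disp)
    also have "integral {s..e} (\<lambda>r. cos (head z r + \<beta>)) + integral {e..t} (\<lambda>r. cos (head z r + \<beta>)) =
                integral {s..t} (\<lambda>r. cos (head z r + \<beta>))"
      using s t im
      by (intro Henstock_Kurzweil_Integration.integral_combine integrable_on_subinterval[OF int]) auto
    also have "integral {0..s} (\<lambda>r. cos (head z r + \<beta>)) + \<dots> = integral {0..t} (\<lambda>r. cos (head z r + \<beta>))"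
      using s t im by (intro Henstock_Kurzweil_Integration.integral_combine int) auto
    finally show ?thesis .
  qed
  have position: "xpos z 0 + integral {0..node z' j} (\<lambda>r. cos (H r)) = xpos z (node z j)"
    "ypos z 0 + integral {0..node z' j} (\<lambda>r. sin (H r)) = ypos z (node z j)" if j: "j \<le> N" for j
  proof -
    \<comment> \<open>No node lies strictly between \<open>s\<close> and \<open>e\<close>: those
      before index \<open>i\<close> are reached by time \<open>s\<close>, the others not before
      \<open>e\<close>.\<close>
    have 1: "integral {0..node z' j} (\<lambda>r. cos (H r + \<beta>)) = integral {0..node z j} (\<lambda>r. cos (head z r + \<beta>))" for \<beta>
    proof (cases "j < i")
      case True
      then have "node z j \<le> node z (i - 1)"
        using i by (intro mono) auto
      then have "node z j \<le> s"
        using s by simp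
      then show ?thesis
        using True by (auto intro!: integral_cong simp: before z'_def)
    next
      case False
      then show ?thesis
        using mono[of i j] mono[of j N] j s disp'[of "node z j"] by (auto simp: z'_def T_def)
    qed
    have sin: "sin r = cos (r + - (pi / 2))" for r :: real
      by (simp add: cos_diff)
    show "xpos z 0 + integral {0..node z' j} (\<lambda>r. cos (H r)) = xpos z (node z j)"
      using 1[of 0] integral_unique[OF feasible_has_integral_cos(1)[OF fz, of 0 "node z j"]] j mono[of j N]
        feasible_node_nonneg[OF fz j] by simp
    show "ypos z 0 + integral {0..node z' j} (\<lambda>r. sin (H r)) = ypos z (node z j)"
      using 1[of "- (pi / 2)"] integral_unique[OF feasible_has_integral_cos(2)[OF fz, of 0 "node z j"]] j mono[of j N]
        feasible_node_nonneg[OF fz j] unfolding sin[symmetric] by simp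
  qed
  have T': "node z' N = T - d"
    using i by (simp add: z'_def T_def)
  have "feasible N a p \<theta>0 \<theta>f z'"
    unfolding feasible_def Let_def T'
  proof (intro conjI ballI)
    show "node z' 0 = 0"
      using i n0 by (simp add: z'_def)
    show "node z' (j - 1) < node z' j" if "j \<in> {1..N}" for j
    proof -
      have "node z (j - 1) < node z j"
        using fz that by (simp add: feasible_def Let_def)
      \<comment> \<open>Only stage \<open>i\<close> shrinks; the removed time \<open>e - m\<close>
        is below \<open>e - s\<close>, hence below its duration.\<close>
      then show ?thesis
        using s by (cases "j = i") (auto simp: z'_def d_def)
    qed
    have "(U has_integral (H (T - d) - H 0)) {0..T - d}"
      using UH by (auto simp: steers_def)
    then show "ctrl z' \<in> borel_measurable (lebesgue_on {0..T - d})"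
      using has_integral_implies_lebesgue_measurable_cbox[of U _ 0 "T - d"] by (simp add: z'_def)
    show "AE \<tau> in lebesgue_on {0..T - d}. \<bar>ctrl z' \<tau>\<bar> \<le> a"
      using UH by (intro AE_I2) (auto simp: steers_def z'_def)
    show "(ctrl z' has_integral (head z' t - head z' 0)) {0..t}" if "t \<in> {0..T - d}" for t
      using UH that by (auto simp: steers_def z'_def)
    show "(xpos z' has_real_derivative cos (head z' t)) (at t within {0..T - d})"
      if "t \<in> {0..T - d}" for t
      using integral_has_real_derivative[of 0 "T - d" "\<lambda>r. cos (H r)" t] contH that
      by (auto simp: z'_def intro!: derivative_eq_intros continuous_intros)
    show "(ypos z' has_real_derivative sin (head z' t)) (at t within {0..T - d})"
      if "t \<in> {0..T - d}" for t
      using integral_has_real_derivative[of 0 "T - d" "\<lambda>r. sin (H r)" t] contH that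
      by (auto simp: z'_def intro!: derivative_eq_intros continuous_intros)
    show "(xpos z' (node z' j), ypos z' (node z' j)) = p j" if "j \<in> {0..N}" for j
    proof -
      have "(xpos z' (node z' j), ypos z' (node z' j)) = (xpos z (node z j), ypos z (node z j))"
        using position[of j] that by (simp add: z'_def)
      then show ?thesis
        using fz that by (simp add: feasible_def Let_def)
    qed
    show "head z' 0 = \<theta>0" "head z' (T - d) = \<theta>f"
      using fz H0 HT by (auto simp: z'_def feasible_def Let_def T_def)
  qed
  then have "T \<le> node z' N"
    using opt by (simp add: optimal_def T_def)
  then show False
    using T' \<open>0 < d\<close> by simp
qed

subsection \<open>A half-circle between opposite arcs is not optimal\<close>

text \<open>By the half-angle formula the left side is at most \<open>x^2 / 2\<close>, which is
  below \<open>x\<close> for \<open>0 < x < 2\<close>.\<close>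

lemma one_minus_cos_less:
  fixes x :: real
  assumes "0 < x" "x < 2"
  shows "1 - cos x < x"
proof -
  have "1 - cos x = 2 * (sin (x / 2))\<^sup>2"
    using cos_double_sin[of "x / 2"] by simp
  also have "(sin (x / 2))\<^sup>2 \<le> (x / 2)\<^sup>2"
    using abs_sin_x_le_abs_x[of "x / 2"] abs_le_square_iff by blast
  also have "2 * (x / 2)\<^sup>2 = (x / 2) * x"
    by (simp add: power2_eq_square)
  also have "\<dots> < 1 * x"
    using assms by (intro mult_strict_right_mono) auto
  finally show ?thesis
    by simp
qed

text \<open>The arcs of length \<open>\<epsilon>\<close> and the half-circle are replaced by two
  arcs with the orientation of the half-circle, joined by a segment parallel to its diameter. The
  signed curvature \<open>c\<close> treats both orientations at once.\<close>

lemma ccc_contradicts_optimal: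
  assumes opt: "optimal N a p \<theta>0 \<theta>f z" and a: "0 < a" and i: "i \<in> {1..N}"
    and c: "c = a \<or> c = - a" and eps: "0 < \<epsilon>" "a * \<epsilon> < pi / 2"
    and m2: "m2 = m1 + pi / a" and s: "node z (i - 1) \<le> m1 - \<epsilon>" and e: "m2 + \<epsilon> \<le> node z i"
    and h1: "\<And>t. t \<in> {m1 - \<epsilon>..m1} \<Longrightarrow> head z t = \<theta> + c * (t - m1)"
    and h2: "\<And>t. t \<in> {m1..m2} \<Longrightarrow> head z t = \<theta> - c * (t - m1)"
    and h3: "\<And>t. t \<in> {m2..m2 + \<epsilon>} \<Longrightarrow> head z t = \<theta> - c * pi / a + c * (t - m2)"
  shows False
proof -
  \<comment> \<open>The signed turning angle of the half-circle, either \<open>pi\<close> or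
    \<open>- pi\<close>; the segment will have the mean heading
    \<open>\<theta> - \<kappa> / 2\<close>.\<close>
  define \<kappa> where "\<kappa> = c * pi / a"
  define s' where "s' = m1 - \<epsilon>"
  \<comment> \<open>The length \<open>l\<close> turns the heading from
    \<open>\<theta> - c * \<epsilon>\<close> to that of the segment, and \<open>d\<close> is the
    segment length that makes the displacements agree.\<close>
  define l where "l = pi / (2 * a) - \<epsilon>"
  define d where "d = 4 * (1 - cos (a * \<epsilon>)) / a"
  define q where "q = s' + l"
  define q' where "q' = q + d"
  define k where "k = cat q (\<lambda>t. \<theta> - c * \<epsilon> + (- c) * (t - s'))
     (cat q' (\<lambda>t. \<theta> - \<kappa> / 2 + 0 * (t - q)) (\<lambda>t. \<theta> - \<kappa> / 2 + (- c) * (t - q')))"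
  define v :: "real \<Rightarrow> real" where "v = cat q (\<lambda>_. - c) (cat q' (\<lambda>_. 0) (\<lambda>_. - c))"
  have c0: "c \<noteq> 0" and ca: "\<bar>c\<bar> = a"
    using a c by auto
  have m12: "m1 \<le> m2"
    using a by (simp add: m2)
  have l: "0 < l"
    using eps a by (simp add: l_def field_simps)
  have d: "0 \<le> d"
    using a by (simp add: d_def)
  \<comment> \<open>The old piece lasts \<open>pi / a + 2 * \<epsilon>\<close> and the new one
    \<open>pi / a - 2 * \<epsilon> + d\<close>, so this is the saving in time. The bound
    \<open>a * \<epsilon> < pi / 2 < 2\<close> admits \<open>one_minus_cos_less\<close>.\<close>
  have "d < 4 * \<epsilon>"
    using one_minus_cos_less[of "a * \<epsilon>"] a eps pi_half_less_two by (simp add: d_def field_simps)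
  then have short: "q' + l < m2 + \<epsilon>"
    by (simp add: q'_def q_def s'_def l_def m2 field_simps)
  have cl: "c * l = \<kappa> / 2 - c * \<epsilon>"
    using a by (simp add: l_def \<kappa>_def algebra_simps)
  have s1: "steers a (\<lambda>_. - c) (\<lambda>t. \<theta> - c * \<epsilon> + (- c) * (t - s')) s' q"
    using l by (intro steers_arc) (simp_all add: ca q_def)
  have s2: "steers a (\<lambda>_. 0) (\<lambda>t. \<theta> - \<kappa> / 2 + 0 * (t - q)) q q'"
    using d a by (intro steers_arc) (simp_all add: q'_def)
  have s3: "steers a (\<lambda>_. - c) (\<lambda>t. \<theta> - \<kappa> / 2 + (- c) * (t - q')) q' (q' + l)"
    using l by (intro steers_arc) (simp_all add: ca)
  have join': "\<theta> - \<kappa> / 2 + 0 * (q' - q) = \<theta> - \<kappa> / 2 + (- c) * (q' - q')"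
    by simp
  note s23 = steers_cat[OF s2 s3 join']
  have join: "\<theta> - c * \<epsilon> + (- c) * (q - s') = cat q' (\<lambda>t. \<theta> - \<kappa> / 2 + 0 * (t - q)) (\<lambda>t. \<theta> - \<kappa> / 2 + (- c) * (t - q')) q"
    using d cl by (auto simp: cat_def q'_def q_def)
  have steer: "steers a v k s' (q' + l)"
    unfolding v_def k_def by (intro steers_cat[OF s1 s23] join)
  \<comment> \<open>Since \<open>\<kappa>\<close> is \<open>pi\<close> or \<open>- pi\<close>, only
    the last formula depends on the orientation, through the sign \<open>c / a\<close>.\<close>
  have trig: "sin (x - \<kappa>) = - sin x" "sin (x - \<kappa> + y) = - sin (x + y)" "cos (x - \<kappa> / 2) = c / a * sin x" for x y
    using c a by (auto simp: \<kappa>_def sin_diff cos_diff sin_add)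
  have "integral {s'..q' + l} (\<lambda>t. cos (k t + \<beta>)) = integral {s'..m2 + \<epsilon>} (\<lambda>t. cos (head z t + \<beta>))" for \<beta>
  proof -
    let ?\<eta> = "\<theta> + \<beta>"
    have "integral {s'..q' + l} (\<lambda>t. cos (k t + \<beta>)) =
        integral {s'..q} (\<lambda>t. cos (\<theta> - c * \<epsilon> + (- c) * (t - s') + \<beta>)) +
        (integral {q..q'} (\<lambda>t. cos (\<theta> - \<kappa> / 2 + 0 * (t - q) + \<beta>)) +
         integral {q'..q' + l} (\<lambda>t. cos (\<theta> - \<kappa> / 2 + (- c) * (t - q') + \<beta>)))"
      unfolding k_def
      using integral_cos_cat[OF steers_continuous_on[OF s1] steers_continuous_on[OF s23] join]
        integral_cos_cat[OF steers_continuous_on[OF s2] steers_continuous_on[OF s3] join'] l d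
      by (simp add: q_def q'_def)
    also have "integral {s'..q} (\<lambda>t. cos (\<theta> - c * \<epsilon> + (- c) * (t - s') + \<beta>)) =
        (sin (\<theta> - \<kappa> / 2 + \<beta>) - sin (\<theta> - c * \<epsilon> + \<beta>)) / - c"
    proof -
      have e: "\<theta> - c * \<epsilon> - c * l + \<beta> = \<theta> - \<kappa> / 2 + \<beta>"
        using cl by simp
      show ?thesis
        using integral_unique[OF has_integral_cos_arc[of "- c" s' q "\<lambda>t. \<theta> - c * \<epsilon> + (- c) * (t - s')" \<beta>]]
          c0 l by (simp add: q_def e)
    qed
    also have "integral {q..q'} (\<lambda>t. cos (\<theta> - \<kappa> / 2 + 0 * (t - q) + \<beta>)) = d * (c / a * sin ?\<eta>)"
    proof -
      have "cos (\<theta> - \<kappa> / 2 + \<beta>) = c / a * sin ?\<eta>"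
        using trig(3)[of ?\<eta>] by (metis add_diff_eq add.commute diff_add_eq)
      then show ?thesis
        using d by (simp add: q'_def)
    qed
    also have "integral {q'..q' + l} (\<lambda>t. cos (\<theta> - \<kappa> / 2 + (- c) * (t - q') + \<beta>)) =
        (- sin (?\<eta> + c * \<epsilon>) - sin (\<theta> - \<kappa> / 2 + \<beta>)) / - c"
    proof -
      have "\<theta> - \<kappa> / 2 + (- c) * l + \<beta> = ?\<eta> - \<kappa> + c * \<epsilon>"
        using cl by simp
      then have "sin (\<theta> - \<kappa> / 2 + (- c) * l + \<beta>) = - sin (?\<eta> + c * \<epsilon>)"
        by (metis trig(2))
      then show ?thesis
        using integral_unique[OF has_integral_cos_arc[of "- c" q' "q' + l" "\<lambda>t. \<theta> - \<kappa> / 2 + (- c) * (t - q')" \<beta>]]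
          c0 l by simp
    qed
    \<comment> \<open>Cosine is even, so \<open>a * \<epsilon>\<close> may be replaced by
      \<open>c * \<epsilon>\<close>, and \<open>c / a = a / c\<close>.\<close>
    also have "d * (c / a * sin ?\<eta>) = 4 * (1 - cos (c * \<epsilon>)) * sin ?\<eta> / c"
      using c a by (auto simp: d_def divide_simps)
    also have "(sin (\<theta> - \<kappa> / 2 + \<beta>) - sin (\<theta> - c * \<epsilon> + \<beta>)) / - c +
        (4 * (1 - cos (c * \<epsilon>)) * sin ?\<eta> / c + (- sin (?\<eta> + c * \<epsilon>) - sin (\<theta> - \<kappa> / 2 + \<beta>)) / - c) =
        (sin (\<theta> - c * \<epsilon> + \<beta>) + sin (?\<eta> + c * \<epsilon>) + 4 * (1 - cos (c * \<epsilon>)) * sin ?\<eta>) / c"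
      by (simp add: add_divide_distrib diff_divide_distrib)
    finally have new: "integral {s'..q' + l} (\<lambda>t. cos (k t + \<beta>)) = \<dots>" .
    have ends: "head z s' = \<theta> - c * \<epsilon>" "head z m1 = \<theta>" "head z m2 = \<theta> - \<kappa>" "head z (m2 + \<epsilon>) = \<theta> - \<kappa> + c * \<epsilon>"
      using h1[of s'] h1[of m1] h3[of m2] h3[of "m2 + \<epsilon>"] eps by (simp_all add: s'_def \<kappa>_def)
    have "((\<lambda>t. cos (head z t + \<beta>)) has_integral
        (sin (head z m1 + \<beta>) - sin (head z s' + \<beta>)) / c) {s'..m1}"
    proof (rule has_integral_cos_arc)
      show "head z t = head z s' + c * (t - s')" if "t \<in> {s'..m1}" for t
        using h1[of t] that unfolding ends by (simp add: s'_def algebra_simps)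
    qed (use c0 eps in \<open>auto simp: s'_def\<close>)
    moreover have "((\<lambda>t. cos (head z t + \<beta>)) has_integral
        (sin (head z m2 + \<beta>) - sin (head z m1 + \<beta>)) / - c) {m1..m2}"
      by (rule has_integral_cos_arc) (use c0 m12 h2 ends in auto)
    moreover have "((\<lambda>t. cos (head z t + \<beta>)) has_integral
        (sin (head z (m2 + \<epsilon>) + \<beta>) - sin (head z m2 + \<beta>)) / c) {m2..m2 + \<epsilon>}"
      by (rule has_integral_cos_arc) (use c0 eps h3 ends in \<open>auto simp: \<kappa>_def\<close>)
    ultimately have int: "((\<lambda>t. cos (head z t + \<beta>)) has_integral
       (sin (head z m1 + \<beta>) - sin (head z s' + \<beta>)) / c +
       ((sin (head z m2 + \<beta>) - sin (head z m1 + \<beta>)) / - c +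
       (sin (head z (m2 + \<epsilon>) + \<beta>) - sin (head z m2 + \<beta>)) / c)) {s'..m2 + \<epsilon>}"
      using m12 eps by (intro has_integral_combine[where c = m1] has_integral_combine[where c = m2]) (auto simp: s'_def)
    have ends': "sin (head z m2 + \<beta>) = - sin ?\<eta>" "sin (head z (m2 + \<epsilon>) + \<beta>) = - sin (?\<eta> + c * \<epsilon>)"
      using trig(1)[of ?\<eta>] trig(2)[of ?\<eta> "c * \<epsilon>"] unfolding ends by (simp_all add: algebra_simps)
    have old: "integral {s'..m2 + \<epsilon>} (\<lambda>t. cos (head z t + \<beta>)) =
        (4 * sin ?\<eta> - sin (\<theta> - c * \<epsilon> + \<beta>) - sin (?\<eta> + c * \<epsilon>)) / c"
      unfolding integral_unique[OF int] ends' ends(1,2) by (simp add: add_divide_distrib diff_divide_distrib)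
    \<comment> \<open>This sum formula turns both displacements into
      \<open>(4 - 2 * cos (c * \<epsilon>)) * sin ?\<eta> / c\<close>.\<close>
    have "sin (\<theta> - c * \<epsilon> + \<beta>) + sin (?\<eta> + c * \<epsilon>) = 2 * cos (c * \<epsilon>) * sin ?\<eta>"
      using sin_add[of ?\<eta> "c * \<epsilon>"] sin_diff[of ?\<eta> "c * \<epsilon>"] by (simp add: diff_add_eq)
    then have "sin (\<theta> - c * \<epsilon> + \<beta>) = 2 * cos (c * \<epsilon>) * sin ?\<eta> - sin (?\<eta> + c * \<epsilon>)"
      by simp
    then show ?thesis
      unfolding new old by (simp add: right_diff_distrib left_diff_distrib)
  qed
  moreover have "k s' = head z s'"
    using l h1[of s'] eps by (simp add: k_def cat_def q_def s'_def)
  moreover have "k (q' + l) = head z (m2 + \<epsilon>)"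
    using l d eps h3[of "m2 + \<epsilon>"] cl by (simp add: k_def cat_def q'_def \<kappa>_def)
  moreover have "s' < q' + l"
    using l d by (simp add: q'_def q_def)
  ultimately show False
    using shortcut_contradicts_optimal[OF opt less_imp_le[OF a] i, of s' "q' + l" "m2 + \<epsilon>" v k] s e short steer
    by (simp add: s'_def)
qed

subsection \<open>Switching in an abnormal stage\<close>

text \<open>A single stage with \<open>l0 = 0\<close>, detached from the trajectory: the switching
  analysis needs neither positions nor other stages.\<close>

locale abnormal_stage =
  fixes a r q l1 l2 :: real and h u l3 :: "real \<Rightarrow> real"
  assumes a_pos: "0 < a" and stage: "r < q"
    and integral_u: "\<And>s t. r \<le> s \<Longrightarrow> s \<le> t \<Longrightarrow> t \<le> q \<Longrightarrow> (u has_integral (h t - h s)) {s..t}"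
    and continuous_h: "continuous_on {r..q} h"
    and nontrivial: "\<And>t. t \<in> {r..q} \<Longrightarrow> (l1, l2, l3 t) \<noteq> (0, 0, 0)"
    and adjoint: "\<And>t. t \<in> {r..q} \<Longrightarrow>
      (l3 has_real_derivative l1 * sin (h t) - l2 * cos (h t)) (at t within {r..q})"
    and bang_bang: "AE t in lebesgue_on {r..<q}. (l3 t < 0 \<longrightarrow> u t = a) \<and> (l3 t > 0 \<longrightarrow> u t = - a)"
    and hamiltonian: "AE t in lebesgue_on {r..<q}. l1 * cos (h t) + l2 * sin (h t) + l3 t * u t = 0"
begin

text \<open>\<open>A\<close> and \<open>B\<close> are the components of the vector
  \<open>(l1, l2)\<close> along the velocity and along its right-hand normal; \<open>B\<close> is
  also the derivative of \<open>l3\<close>.\<close>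

definition A :: "real \<Rightarrow> real" where "A t = l1 * cos (h t) + l2 * sin (h t)"

definition B :: "real \<Rightarrow> real" where "B t = l1 * sin (h t) - l2 * cos (h t)"

lemma continuous_l3: "continuous_on {r..q} l3"
  using adjoint by (intro DERIV_continuous_on) auto

text \<open>The bang-bang law and the Hamiltonian condition give the identity almost everywhere.
  Both sides are continuous, so the nonnegative \<open>f\<close> with zero integral vanishes
  everywhere.\<close>

lemma A_eq: "A t = a * \<bar>l3 t\<bar>" if t: "t \<in> {r..q}"
proof -
  define f where "f = (\<lambda>t. \<bar>A t - a * \<bar>l3 t\<bar>\<bar>)"
  \<comment> \<open>The point \<open>q\<close> joins the exceptional set because the conditions are
    imposed on a half-open interval.\<close>
  define S where "S = {t \<in> {r..<q}. \<not> ((l3 t < 0 \<longrightarrow> u t = a) \<and> (l3 t > 0 \<longrightarrow> u t = - a))} \<union>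
    {t \<in> {r..<q}. \<not> l1 * cos (h t) + l2 * sin (h t) + l3 t * u t = 0} \<union> {q}"
  have S: "negligible S"
    unfolding S_def
    using AE_lebesgue_on_iff_negligible[THEN iffD1, OF _ bang_bang]
      AE_lebesgue_on_iff_negligible[THEN iffD1, OF _ hamiltonian]
    by (intro negligible_Un) auto
  have "f t = 0" if t: "t \<in> {r..q} - S" for t
  proof -
    have "(l3 t < 0 \<longrightarrow> u t = a) \<and> (l3 t > 0 \<longrightarrow> u t = - a)" "A t + l3 t * u t = 0"
      using t by (auto simp: S_def A_def)
    then show ?thesis
      by (cases "l3 t" "0 :: real" rule: linorder_cases) (auto simp: f_def mult.commute)
  qed
  then have "(f has_integral 0) {r..q}"
    by (rule has_integral_spike[OF S _ has_integral_0])
  moreover have "continuous_on {r..q} f"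
    unfolding f_def A_def by (intro continuous_intros continuous_h continuous_l3)
  ultimately show ?thesis
    using integral_eq_0_iff[of r q f] stage t by (simp add: f_def integral_unique)
qed

lemma A_nonneg: "0 \<le> A t" if "t \<in> {r..q}"
  using A_eq[OF that] a_pos by simp

text \<open>At a zero of \<open>l3\<close> also \<open>A\<close> vanishes; were \<open>B\<close>
  zero too, the norm of \<open>(l1, l2)\<close> would be zero, against nontriviality.\<close>

lemma B_nonzero: "B t \<noteq> 0" if t: "t \<in> {r..q}" "l3 t = 0"
proof
  assume "B t = 0"
  moreover have "A t = 0"
    using A_eq t by simp
  moreover have "(A t)\<^sup>2 + (B t)\<^sup>2 = (l1\<^sup>2 + l2\<^sup>2) * ((sin (h t))\<^sup>2 + (cos (h t))\<^sup>2)"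
    unfolding A_def B_def by algebra
  ultimately show False
    using nontrivial[OF t(1)] t(2) by simp
qed

lemma rotate:
  assumes "h t = h s + x"
  shows "A t = A s * cos x - B s * sin x" and "B t = B s * cos x + A s * sin x"
  unfolding A_def B_def assms by (simp_all add: sin_add cos_add algebra_simps)

lemma constant_sign:
  assumes "r \<le> s" "s < t" "t \<le> q" and nz: "\<And>x. x \<in> {s<..<t} \<Longrightarrow> l3 x \<noteq> 0"
  obtains \<sigma> where "\<sigma> = 1 \<or> \<sigma> = - 1" "\<forall>x\<in>{s<..<t}. 0 < \<sigma> * l3 x"
proof -
  define m where "m = (s + t) / 2"
  have m: "m \<in> {s<..<t}"
    using assms by (auto simp: m_def)
  have "continuous_on {s<..<t} l3"
    using continuous_l3 assms by (auto elim: continuous_on_subset)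
  then have conn: "connected (l3 ` {s<..<t})"
    by (intro connected_continuous_image) auto
  have "0 < sgn (l3 m) * l3 x" if x: "x \<in> {s<..<t}" for x
  proof (rule ccontr)
    assume "\<not> 0 < sgn (l3 m) * l3 x"
    then have "l3 m \<le> 0 \<and> 0 \<le> l3 x \<or> l3 x \<le> 0 \<and> 0 \<le> l3 m"
      by (auto simp: sgn_if not_less split: if_splits)
    then have "0 \<in> l3 ` {s<..<t}"
      using conn m x unfolding connected_iff_interval by blast
    then show False
      using nz by auto
  qed
  moreover have "sgn (l3 m) = 1 \<or> sgn (l3 m) = - 1"
    using nz[OF m] by (auto simp: sgn_if)
  ultimately show thesis
    using that by blast
qed

text \<open>A fixed sign of \<open>l3\<close> fixes the control. For the length: a half-turn sends
  \<open>A\<close> to its negative, whereas \<open>A\<close> is nonnegative at \<open>s\<close> and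
  positive inside the arc.\<close>

lemma arc:
  assumes "r \<le> s" "s < t" "t \<le> q" and \<sigma>: "\<sigma> = 1 \<or> \<sigma> = - 1"
    and pos: "\<forall>x\<in>{s<..<t}. 0 < \<sigma> * l3 x"
  shows "AE x in lebesgue_on {s..t}. u x = - \<sigma> * a"
    and "\<And>x. x \<in> {s..t} \<Longrightarrow> h x = h s - \<sigma> * a * (x - s)"
    and "t - s \<le> pi / a"
proof -
  define S where "S = {t \<in> {r..<q}. \<not> ((l3 t < 0 \<longrightarrow> u t = a) \<and> (l3 t > 0 \<longrightarrow> u t = - a))} \<union> {s, t}"
  have S: "negligible S"
    unfolding S_def
    using AE_lebesgue_on_iff_negligible[THEN iffD1, OF _ bang_bang] by (intro negligible_Un) auto
  have u: "u x = - \<sigma> * a" if "x \<in> {s..t} - S" for x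
  proof -
    have "0 < \<sigma> * l3 x" "x \<in> {r..<q}"
      using that bspec[OF pos, of x] assms(1-3) by (auto simp: S_def)
    then show ?thesis
      using that \<sigma> by (auto simp: S_def)
  qed
  then have "negligible {x \<in> {s..t}. \<not> u x = - \<sigma> * a}"
    by (intro negligible_subset[OF S]) auto
  then show "AE x in lebesgue_on {s..t}. u x = - \<sigma> * a"
    by (subst AE_lebesgue_on_iff_negligible) auto
  show h: "h x = h s - \<sigma> * a * (x - s)" if x: "x \<in> {s..t}" for x
  proof -
    have "((\<lambda>_. - \<sigma> * a) has_integral ((x - s) *\<^sub>R (- \<sigma> * a))) {s..x}"
      using has_integral_const_real[of "- \<sigma> * a" s x] x by simp
    then have "(u has_integral ((x - s) *\<^sub>R (- \<sigma> * a))) {s..x}"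
      by (rule has_integral_spike[OF S, rotated]) (use u x in auto)
    moreover have "(u has_integral (h x - h s)) {s..x}"
      using assms x by (intro integral_u) auto
    ultimately have "(x - s) *\<^sub>R (- \<sigma> * a) = h x - h s"
      by (rule has_integral_unique)
    then show ?thesis
      by (simp add: algebra_simps)
  qed
  show "t - s \<le> pi / a"
  proof (rule ccontr)
    \<comment> \<open>The point a half-turn after \<open>s\<close>; it would lie inside an arc that
      is too long.\<close>
    define x where "x = s + pi / a"
    assume "\<not> t - s \<le> pi / a"
    then have x: "x \<in> {s<..<t}"
      using a_pos by (auto simp: x_def)
    then have "h x = h s + - \<sigma> * pi"
      using h[of x] a_pos by (simp add: x_def)
    then have "A x = A s * cos (- \<sigma> * pi) - B s * sin (- \<sigma> * pi)"
      by (rule rotate(1))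
    then have "A x = - A s"
      using \<sigma> by auto
    moreover have "0 \<le> A s"
      using assms by (intro A_nonneg) auto
    moreover have "A x > 0"
    proof -
      have "l3 x \<noteq> 0"
        using bspec[OF pos x] by auto
      then show ?thesis
        using A_eq[of x] a_pos x assms(1,3) by simp
    qed
    ultimately show False
      by simp
  qed
qed

text \<open>At a zero the derivative of \<open>l3\<close> is \<open>B m\<close>, which is nonzero,
  so \<open>l3\<close> changes sign there; multiplying by \<open>sgn (B m)\<close> reduces this to
  an increasing crossing.\<close>

lemma crossing:
  assumes m: "m \<in> {r<..<q}" "l3 m = 0"
  obtains \<delta> where "0 < \<delta>" "r \<le> m - \<delta>" "m + \<delta> \<le> q"
    "\<And>x. x \<in> {m<..<m + \<delta>} \<Longrightarrow> 0 < sgn (B m) * l3 x"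
    "\<And>x. x \<in> {m - \<delta><..<m} \<Longrightarrow> 0 < - sgn (B m) * l3 x"
proof -
  define g where "g = (\<lambda>x. sgn (B m) * l3 x)"
  have der: "(g has_real_derivative sgn (B m) * B m) (at m within {r..q})"
    unfolding g_def using adjoint[of m] m by (auto intro!: DERIV_cmult simp: B_def)
  have pos: "0 < sgn (B m) * B m"
    using B_nonzero[of m] m by (auto simp: sgn_if)
  obtain d where d: "d > 0" "\<And>x. x > 0 \<Longrightarrow> m + x \<in> {r..q} \<Longrightarrow> x < d \<Longrightarrow> g m < g (m + x)"
    using has_real_derivative_pos_inc_right[OF der pos] by blast
  obtain d' where d': "d' > 0" "\<And>x. x > 0 \<Longrightarrow> m - x \<in> {r..q} \<Longrightarrow> x < d' \<Longrightarrow> g (m - x) < g m"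
    using has_real_derivative_pos_inc_left[OF der pos] by blast
  define \<delta> where "\<delta> = min (min d d') (min (m - r) (q - m))"
  have "0 < g x" if "x \<in> {m<..<m + \<delta>}" for x
    using d(2)[of "x - m"] that m by (auto simp: \<delta>_def g_def)
  moreover have "g x < 0" if "x \<in> {m - \<delta><..<m}" for x
    using d'(2)[of "m - x"] that m by (auto simp: \<delta>_def g_def)
  ultimately show thesis
    using d(1) d'(1) m by (intro that[of \<delta>]) (auto simp: \<delta>_def g_def)
qed

text \<open>The half-circle runs from \<open>m\<close> to the next zero \<open>n\<close>, which need
  not be \<open>m'\<close>. As \<open>l3\<close> changes sign at both, the neighbouring arcs turn
  the opposite way.\<close>

lemma two_zeros_imp_ccc:
  assumes m: "m \<in> {r<..<q}" "l3 m = 0" and m': "m' \<in> {r<..<q}" "l3 m' = 0" and "m < m'"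
  obtains c n \<epsilon> where "c = a \<or> c = - a" "n = m + pi / a" "0 < \<epsilon>" "a * \<epsilon> < pi / 2"
    "r \<le> m - \<epsilon>" "n + \<epsilon> \<le> q"
    "\<And>t. t \<in> {m - \<epsilon>..m} \<Longrightarrow> h t = h m + c * (t - m)"
    "\<And>t. t \<in> {m..n} \<Longrightarrow> h t = h m - c * (t - m)"
    "\<And>t. t \<in> {n..n + \<epsilon>} \<Longrightarrow> h t = h m - c * pi / a + c * (t - n)"
proof -
  obtain \<delta> where \<delta>: "0 < \<delta>" "r \<le> m - \<delta>" "m + \<delta> \<le> q"
    "\<And>x. x \<in> {m<..<m + \<delta>} \<Longrightarrow> 0 < sgn (B m) * l3 x"
    "\<And>x. x \<in> {m - \<delta><..<m} \<Longrightarrow> 0 < - sgn (B m) * l3 x"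
    by (rule crossing[OF m]) blast
  define \<sigma> where "\<sigma> = sgn (B m)"
  have Bm: "B m \<noteq> 0"
    using m by (intro B_nonzero) auto
  then have \<sigma>: "\<sigma> = 1 \<or> \<sigma> = - 1"
    by (auto simp: \<sigma>_def sgn_if)
  \<comment> \<open>Starting at \<open>m + \<delta> / 2\<close> excludes \<open>m\<close> while
    keeping the set closed, and no zero is lost, since \<open>l3\<close> has none between
    \<open>m\<close> and \<open>m + \<delta>\<close>.\<close>
  define Z where "Z = {t \<in> {m + \<delta> / 2..m'}. l3 t = 0}"
  have "m + \<delta> \<le> m'"
    using \<delta>(4)[of m'] m' \<open>m < m'\<close> by (cases "m' < m + \<delta>") auto
  then have "m' \<in> Z"
    using m' \<delta>(1) by (auto simp: Z_def)
  have "continuous_on {m + \<delta> / 2..m'} l3"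
    using continuous_l3 m m' \<delta>(1) by (auto elim: continuous_on_subset)
  then have "closed Z"
    using continuous_closed_preimage[of "{m + \<delta> / 2..m'}" l3 "{0}"]
    by (simp add: Z_def vimage_def Int_def)
  moreover have "bounded Z"
    by (rule bounded_subset[OF bounded_closed_interval[of "m + \<delta> / 2" m']]) (auto simp: Z_def)
  ultimately have "compact Z"
    by (simp add: compact_eq_bounded_closed)
  then obtain n where n: "n \<in> Z" "\<And>t. t \<in> Z \<Longrightarrow> n \<le> t"
    using compact_attains_inf[of Z] \<open>m' \<in> Z\<close> by auto
  have mn: "m + \<delta> / 2 \<le> n" "n < q" "l3 n = 0"
    using n(1) m' by (auto simp: Z_def)
  have nz: "l3 x \<noteq> 0" if x: "x \<in> {m<..<n}" for x
  proof (cases "x < m + \<delta>")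
    case True
    then show ?thesis
      using \<delta>(4)[of x] x by auto
  next
    case False
    then show ?thesis
      using n(2)[of x] n(1) x \<delta>(1) by (auto simp: Z_def)
  qed
  obtain \<sigma>' where \<sigma>': "\<sigma>' = 1 \<or> \<sigma>' = - 1" "\<forall>x\<in>{m<..<n}. 0 < \<sigma>' * l3 x"
    using constant_sign[of m n] nz m mn \<delta>(1) by auto
  \<comment> \<open>The signs are compared at \<open>m + \<delta> / 4\<close>, which precedes
    \<open>n\<close>.\<close>
  have "\<sigma>' = \<sigma>"
    using bspec[OF \<sigma>'(2), of "m + \<delta> / 4"] \<delta>(4)[of "m + \<delta> / 4"] \<delta>(1) mn(1) \<sigma> \<sigma>'(1)
    unfolding \<sigma>_def[symmetric] by auto
  have "r \<le> m" "m < n" "n \<le> q"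
    using m mn \<delta>(1) by auto
  note arc_mn = arc[OF this \<sigma> \<sigma>'(2)[unfolded \<open>\<sigma>' = \<sigma>\<close>]]
  have le: "a * (n - m) \<le> pi"
    using arc_mn(3) a_pos by (simp add: field_simps)
  have "h n = h m + - \<sigma> * (a * (n - m))"
    using arc_mn(2)[of n] \<open>m < n\<close> by simp
  note rot = rotate[OF this]
  have "A m = 0" "A n = 0"
    using A_eq[of m] A_eq[of n] m mn \<delta>(1) by auto
  \<comment> \<open>Both ends being zeros of \<open>A\<close>, the rotation formula leaves only
    \<open>B m\<close> times this sine. As the angle is positive and at most \<open>pi\<close>, it
    must be \<open>pi\<close>.\<close>
  then have "sin (a * (n - m)) = 0"
    using rot(1) Bm \<sigma> by auto
  then have "a * (n - m) = pi"
    using le sin_gt_zero[of "a * (n - m)"] a_pos \<open>m < n\<close> by (cases "a * (n - m) < pi") auto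
  then have Bn: "B n = - B m" and n_eq: "n = m + pi / a"
    using rot(2) \<open>A m = 0\<close> \<sigma> a_pos by (auto simp: field_simps)
  have n_in: "n \<in> {r<..<q}"
    using mn m \<delta>(1) by auto
  obtain \<eta> where \<eta>: "0 < \<eta>" "r \<le> n - \<eta>" "n + \<eta> \<le> q"
    "\<And>x. x \<in> {n<..<n + \<eta>} \<Longrightarrow> 0 < sgn (B n) * l3 x"
    by (rule crossing[OF n_in mn(3)]) blast
  have sgn_n: "sgn (B n) = - \<sigma>"
    by (simp add: Bn \<sigma>_def sgn_minus)
  have \<sigma>_neg: "- \<sigma> = 1 \<or> - \<sigma> = - 1"
    using \<sigma> by auto
  \<comment> \<open>The last bound ensures \<open>a * \<epsilon> < pi / 2\<close>; the others keep
    the outer arcs where the sign of \<open>l3\<close> is known.\<close>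
  define \<epsilon> where "\<epsilon> = min (min \<delta> \<eta>) (pi / (4 * a))"
  have eps: "0 < \<epsilon>" "\<epsilon> \<le> \<delta>" "\<epsilon> \<le> \<eta>" "\<epsilon> \<le> pi / (4 * a)"
    using \<delta>(1) \<eta>(1) a_pos by (auto simp: \<epsilon>_def)
  have "r \<le> m - \<epsilon>" "m - \<epsilon> < m" "m \<le> q" "\<forall>x\<in>{m - \<epsilon><..<m}. 0 < - \<sigma> * l3 x"
    using eps \<delta>(2,5) m by (auto simp: \<sigma>_def)
  note before = arc(2)[OF this(1-3) \<sigma>_neg this(4)]
  have "r \<le> n" "n < n + \<epsilon>" "n + \<epsilon> \<le> q" "\<forall>x\<in>{n<..<n + \<epsilon>}. 0 < - \<sigma> * l3 x"
    using eps \<eta>(3) \<eta>(4)[unfolded sgn_n] n_in by auto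
  note after = arc(2)[OF this(1-3) \<sigma>_neg this(4)]
  show thesis
  proof (rule that[of "\<sigma> * a" n \<epsilon>])
    show "\<sigma> * a = a \<or> \<sigma> * a = - a"
      using \<sigma> by auto
    have "a * \<epsilon> \<le> a * (pi / (4 * a))"
      using eps(4) a_pos by (intro mult_left_mono) auto
    also have "\<dots> < pi / 2"
      using a_pos by simp
    finally show "a * \<epsilon> < pi / 2" .
    show "h t = h m + \<sigma> * a * (t - m)" if "t \<in> {m - \<epsilon>..m}" for t
      using before[OF that] before[of m] eps(1) by (simp add: algebra_simps)
    show "h t = h m - \<sigma> * a * (t - m)" if "t \<in> {m..n}" for t
      by (rule arc_mn(2)[OF that])
    show "h t = h m - \<sigma> * a * pi / a + \<sigma> * a * (t - n)" if "t \<in> {n..n + \<epsilon>}" for t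
      using after[OF that] arc_mn(2)[of n] \<open>m < n\<close> n_eq a_pos by simp
    show "n = m + pi / a" "0 < \<epsilon>" "r \<le> m - \<epsilon>" "n + \<epsilon> \<le> q"
      by fact+
  qed
qed

end

section \<open>Arc types and lengths of single stages\<close>

lemma C_type_1:
  assumes "s < e" "c = a \<or> c = - a" "AE t in lebesgue_on {s..e}. ctrl z t = c"
  shows "C_type a z s e 1"
  unfolding C_type_def
  using assms by (intro exI[of _ "\<lambda>j. if j = 0 then s else e"] exI[of _ "\<lambda>_. c"]) auto

lemma C_type_2:
  assumes "s < m" "m < e" "c = a \<or> c = - a"
    and "AE t in lebesgue_on {s..m}. ctrl z t = c" "AE t in lebesgue_on {m..e}. ctrl z t = - c"
  shows "C_type a z s e 2"
  unfolding C_type_def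
  using assms
  by (intro exI[of _ "\<lambda>j. if j = 0 then s else if j = 1 then m else e"]
        exI[of _ "\<lambda>j. if j = 0 then c else - c"]) (auto simp: less_2_cases_iff)

text \<open>Without an interior zero the stage is one arc. A single interior zero is a genuine
  switch by \<open>crossing\<close>, and each of the two arcs has length at most
  \<open>pi / a\<close>.\<close>

lemma (in abnormal_stage) stage_type:
  assumes u: "u = ctrl z"
    and single: "\<And>m m'. m \<in> {r<..<q} \<Longrightarrow> l3 m = 0 \<Longrightarrow> m' \<in> {r<..<q} \<Longrightarrow> l3 m' = 0 \<Longrightarrow> m = m'"
  shows "C_type a z r q 2 \<and> q - r \<le> 2 * pi / a \<or> C_type a z r q 1 \<and> q - r \<le> pi / a"
proof (cases "\<exists>m\<in>{r<..<q}. l3 m = 0")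
  case False
  then obtain \<sigma> where \<sigma>: "\<sigma> = 1 \<or> \<sigma> = - 1" "\<forall>x\<in>{r<..<q}. 0 < \<sigma> * l3 x"
    using constant_sign[of r q] stage by auto
  have "C_type a z r q 1"
  proof (rule C_type_1[OF stage])
    show "- \<sigma> * a = a \<or> - \<sigma> * a = - a"
      using \<sigma>(1) by auto
    show "AE t in lebesgue_on {r..q}. ctrl z t = - \<sigma> * a"
      using arc(1)[OF _ stage _ \<sigma>] unfolding u by simp
  qed
  then show ?thesis
    using arc(3)[OF _ stage _ \<sigma>] by simp
next
  case True
  then obtain m where m: "m \<in> {r<..<q}" "l3 m = 0"
    by auto
  obtain \<delta> where \<delta>: "0 < \<delta>" "r \<le> m - \<delta>" "m + \<delta> \<le> q"
    "\<And>x. x \<in> {m<..<m + \<delta>} \<Longrightarrow> 0 < sgn (B m) * l3 x"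
    "\<And>x. x \<in> {m - \<delta><..<m} \<Longrightarrow> 0 < - sgn (B m) * l3 x"
    by (rule crossing[OF m]) blast
  define \<sigma> where "\<sigma> = sgn (B m)"
  have \<sigma>: "\<sigma> = 1 \<or> \<sigma> = - 1"
    using B_nonzero[of m] m by (auto simp: \<sigma>_def sgn_if)
  have nz: "l3 x \<noteq> 0" if "x \<in> {r<..<m} \<union> {m<..<q}" for x
    using single[OF m, of x] that m by auto
  obtain \<sigma>1 where \<sigma>1: "\<sigma>1 = 1 \<or> \<sigma>1 = - 1" "\<forall>x\<in>{r<..<m}. 0 < \<sigma>1 * l3 x"
    using constant_sign[of r m] nz m by auto
  have "\<sigma>1 = - \<sigma>"
    using bspec[OF \<sigma>1(2), of "m - \<delta> / 2"] \<delta>(5)[of "m - \<delta> / 2"] \<delta>(1,2) \<sigma> \<sigma>1(1)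
    unfolding \<sigma>_def[symmetric] by auto
  obtain \<sigma>2 where \<sigma>2: "\<sigma>2 = 1 \<or> \<sigma>2 = - 1" "\<forall>x\<in>{m<..<q}. 0 < \<sigma>2 * l3 x"
    using constant_sign[of m q] nz m by auto
  have "\<sigma>2 = \<sigma>"
    using bspec[OF \<sigma>2(2), of "m + \<delta> / 2"] \<delta>(4)[of "m + \<delta> / 2"] \<delta>(1,3) \<sigma> \<sigma>2(1)
    unfolding \<sigma>_def[symmetric] by auto
  have rm: "r \<le> r" "r < m" "m \<le> q" and mq: "r \<le> m" "m < q" "q \<le> q"
    using m by auto
  have "C_type a z r q 2"
  proof (rule C_type_2[OF rm(2) mq(2)])
    show "\<sigma> * a = a \<or> \<sigma> * a = - a"
      using \<sigma> by auto
    show "AE t in lebesgue_on {r..m}. ctrl z t = \<sigma> * a"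
      using arc(1)[OF rm \<sigma>1] unfolding u \<open>\<sigma>1 = - \<sigma>\<close> by simp
    show "AE t in lebesgue_on {m..q}. ctrl z t = - (\<sigma> * a)"
      using arc(1)[OF mq \<sigma>2] unfolding u \<open>\<sigma>2 = \<sigma>\<close> by simp
  qed
  then show ?thesis
    using arc(3)[OF rm \<sigma>1] arc(3)[OF mq \<sigma>2] by simp
qed

text \<open>The path has unit speed. Strictness of \<open>s < e\<close> makes the derivative within
  the interval unique, also at its ends.\<close>

lemma feasible_path_length:
  assumes fz: "feasible N a p \<theta>0 \<theta>f z" and "0 \<le> s" "s < e" "e \<le> node z N"
  shows "path_length z s e = e - s"
proof -
  have "norm (vector_derivative (\<lambda>r. (xpos z r, ypos z r)) (at t within {s..e})) = 1"
    if t: "t \<in> {s..e}" for t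
  proof -
    have "(xpos z has_real_derivative cos (head z t)) (at t within {s..e})"
         "(ypos z has_real_derivative sin (head z t)) (at t within {s..e})"
      using assms t unfolding feasible_def Let_def
      by (auto intro!: DERIV_subset[where s = "{0..node z N}" and t = "{s..e}"])
    then have "((\<lambda>r. (xpos z r, ypos z r)) has_vector_derivative (cos (head z t), sin (head z t)))
        (at t within {s..e})"
      by (intro has_vector_derivative_Pair) (simp_all add: has_real_derivative_iff_has_vector_derivative)
    then have "vector_derivative (\<lambda>r. (xpos z r, ypos z r)) (at t within {s..e}) = (cos (head z t), sin (head z t))"
      by (rule vector_derivative_within_closed_interval[OF \<open>s < e\<close> t])
    then show ?thesis
      by (simp add: norm_Pair)
  qed
  then have "path_length z s e = integral {s..e} (\<lambda>_. 1 :: real)"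
    unfolding path_length_def by (intro integral_cong) auto
  then show ?thesis
    using \<open>s < e\<close> by simp
qed

section \<open>From the stages to the whole path\<close>

lemma abnormal_stage_if_multipliers:
  assumes fz: "feasible N a p \<theta>0 \<theta>f z" and a: "0 < a" and mult: "multipliers N a z 0 l1 l2 l3"
    and i: "i \<in> {1..N}"
  shows "abnormal_stage a (node z (i - 1)) (node z i) (l1 i) (l2 i) (head z) (ctrl z) l3"
proof
  have range: "0 \<le> node z (i - 1)" "node z i \<le> node z N"
    using feasible_node_nonneg[OF fz, of "i - 1"] feasible_node_mono[OF fz, of i N] i by auto
  show "0 < a"
    by (rule a)
  show "node z (i - 1) < node z i"
    using fz i by (simp add: feasible_def Let_def)
  have int: "(ctrl z has_integral (head z t - head z 0)) {0..t}" if "t \<in> {0..node z N}" for t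
    using fz that unfolding feasible_def Let_def by blast
  show "(ctrl z has_integral (head z t - head z s)) {s..t}"
    if "node z (i - 1) \<le> s" "s \<le> t" "t \<le> node z i" for s t
    by (rule has_integral_increment[OF int]) (use range that in simp_all)
  show "continuous_on {node z (i - 1)..node z i} (head z)"
    using steers_continuous_on[OF feasible_steers[OF fz less_imp_le[OF a]]] range
    by (auto elim: continuous_on_subset)
  note stage = bspec[OF conjunct2[OF conjunct2[OF mult[unfolded multipliers_def]]] i]
  note nonzero = conjunct1[OF conjunct2[OF stage]]
    and adjoint = conjunct1[OF conjunct2[OF conjunct2[OF stage]]]
    and bang = conjunct1[OF conjunct2[OF conjunct2[OF conjunct2[OF stage]]]]
    and ham = conjunct2[OF conjunct2[OF conjunct2[OF conjunct2[OF stage]]]]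
  show "(l1 i, l2 i, l3 t) \<noteq> (0, 0, 0)" if "t \<in> {node z (i - 1)..node z i}" for t
    using bspec[OF nonzero that] by simp
  show "(l3 has_real_derivative l1 i * sin (head z t) - l2 i * cos (head z t))
      (at t within {node z (i - 1)..node z i})" if "t \<in> {node z (i - 1)..node z i}" for t
    by (rule bspec[OF adjoint that])
  show "AE t in lebesgue_on {node z (i - 1)..<node z i}.
      (l3 t < 0 \<longrightarrow> ctrl z t = a) \<and> (0 < l3 t \<longrightarrow> ctrl z t = - a)"
    by (rule bang)
  show "AE t in lebesgue_on {node z (i - 1)..<node z i}.
      l1 i * cos (head z t) + l2 i * sin (head z t) + l3 t * ctrl z t = 0"
    using ham by simp
qed

text \<open>Two interior zeros of \<open>l3\<close> would produce the configuration excluded by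
  optimality, so \<open>stage_type\<close> applies.\<close>

lemma stage_of_abnormal_optimal:
  assumes a: "0 < a" and opt: "optimal N a p \<theta>0 \<theta>f z" and "abnormal N a z" and i: "i \<in> {1..N}"
  defines "r \<equiv> node z (i - 1)" and "q \<equiv> node z i"
  shows "C_type a z r q 2 \<and> q - r \<le> 2 * pi / a \<or> C_type a z r q 1 \<and> q - r \<le> pi / a"
proof -
  have fz: "feasible N a p \<theta>0 \<theta>f z"
    using opt by (simp add: optimal_def)
  obtain l1 l2 l3 where "multipliers N a z 0 l1 l2 l3"
    using assms(3) by (auto simp: abnormal_def)
  from abnormal_stage_if_multipliers[OF fz a this i]
  interpret abnormal_stage a r q "l1 i" "l2 i" "head z" "ctrl z" l3
    by (simp add: r_def q_def)
  have two: False if m: "m \<in> {r<..<q}" "l3 m = 0" "m' \<in> {r<..<q}" "l3 m' = 0" "m < m'" for m m'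
  proof -
    obtain c n \<epsilon> where c: "c = a \<or> c = - a" "n = m + pi / a" "0 < \<epsilon>" "a * \<epsilon> < pi / 2"
      "r \<le> m - \<epsilon>" "n + \<epsilon> \<le> q"
      "\<And>t. t \<in> {m - \<epsilon>..m} \<Longrightarrow> head z t = head z m + c * (t - m)"
      "\<And>t. t \<in> {m..n} \<Longrightarrow> head z t = head z m - c * (t - m)"
      "\<And>t. t \<in> {n..n + \<epsilon>} \<Longrightarrow> head z t = head z m - c * pi / a + c * (t - n)"
      by (rule two_zeros_imp_ccc[OF m]) blast
    then show False
      by (intro ccc_contradicts_optimal[OF opt a i c(1,3,4,2) c(5,6)[unfolded r_def q_def] c(7,8,9)])
  qed
  show ?thesis
  proof (rule stage_type[OF refl])
    show "m = m'" if "m \<in> {r<..<q}" "l3 m = 0" "m' \<in> {r<..<q}" "l3 m' = 0" for m m'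
      using two[of m m'] two[of m' m] that by (cases m m' rule: linorder_cases) blast+
  qed
qed

theorem lemma6:
  fixes N :: nat and a \<theta>0 \<theta>f :: real and p :: "nat \<Rightarrow> real \<times> real" and z :: trajectory
  assumes "N \<ge> 1" and "a > 0"
    and "\<forall>i\<in>{1..N}. p (i - 1) \<noteq> p i"
    and "optimal N a p \<theta>0 \<theta>f z"
    and "abnormal N a z"
  shows "(\<forall>i\<in>{1..N}.
            (C_type a z (node z (i - 1)) (node z i) 2 \<and>
               path_length z (node z (i - 1)) (node z i) \<le> 2 * pi / a) \<or>
            (C_type a z (node z (i - 1)) (node z i) 1 \<and>
               path_length z (node z (i - 1)) (node z i) \<le> pi / a)) \<and>
         (\<exists>k :: nat \<Rightarrow> nat.
            (\<forall>i\<in>{1..N}. C_type a z (node z (i - 1)) (node z i) (k i)) \<and>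
            N \<le> (\<Sum>i=1..N. k i) \<and> (\<Sum>i=1..N. k i) \<le> 2 * N \<and>
            path_length z 0 (node z N) \<le> 2 * real N * pi / a)"
proof -
  have fz: "feasible N a p \<theta>0 \<theta>f z"
    using assms(4) by (simp add: optimal_def)
  have n0: "node z 0 = 0"
    using fz by (simp add: feasible_def Let_def)
  have len: "path_length z (node z (i - 1)) (node z i) = node z i - node z (i - 1)" if "i \<in> {1..N}" for i
  proof (rule feasible_path_length[OF fz])
    show "node z (i - 1) < node z i"
      using fz that by (simp add: feasible_def Let_def)
  qed (use that feasible_node_nonneg[OF fz, of "i - 1"] feasible_node_mono[OF fz, of i N] in auto)
  have stage: "C_type a z (node z (i - 1)) (node z i) 2 \<and> node z i - node z (i - 1) \<le> 2 * pi / a \<or>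
      C_type a z (node z (i - 1)) (node z i) 1 \<and> node z i - node z (i - 1) \<le> pi / a"
    if "i \<in> {1..N}" for i
    by (rule stage_of_abnormal_optimal[OF assms(2,4,5) that])
  then have "\<exists>k. k \<in> {1, 2} \<and> C_type a z (node z (i - 1)) (node z i) k" if "i \<in> {1..N}" for i
    using that by blast
  then obtain k where k: "\<And>i. i \<in> {1..N} \<Longrightarrow> k i \<in> {1, 2} \<and> C_type a z (node z (i - 1)) (node z i) (k i)"
    by metis
  have "(\<Sum>i=1..N. 1) \<le> (\<Sum>i=1..N. k i)" "(\<Sum>i=1..N. k i) \<le> (\<Sum>i=1..N. 2)"
    using k by (intro sum_mono; fastforce)+
  then have sum: "N \<le> (\<Sum>i=1..N. k i)" "(\<Sum>i=1..N. k i) \<le> 2 * N"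
    by simp_all
  \<comment> \<open>The total time telescopes into stage durations, each at most
    \<open>2 * pi / a\<close> in either case.\<close>
  have "node z N = (\<Sum>i=1..N. node z i - node z (i - 1))"
    using sum_telescope''[of 0 N "node z"] n0 by simp
  also have "\<dots> \<le> (\<Sum>i=1..N. 2 * pi / a)"
  proof (rule sum_mono)
    fix i assume "i \<in> {1..N}"
    moreover have "pi / a \<le> 2 * pi / a"
      using assms(2) by (intro divide_right_mono) auto
    ultimately show "node z i - node z (i - 1) \<le> 2 * pi / a"
      using stage[of i] by auto
  qed
  also have "\<dots> = 2 * real N * pi / a"
    by simp
  finally have "node z N \<le> 2 * real N * pi / a" .
  \<comment> \<open>The length formula requires a nondegenerate interval, which
    \<open>N \<ge> 1\<close> provides.\<close>
  moreover have "0 < node z N"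
  proof -
    have "node z (N - 1) < node z N"
      using fz assms(1) by (simp add: feasible_def Let_def)
    then show ?thesis
      using feasible_node_nonneg[OF fz, of "N - 1"] by simp
  qed
  then have "path_length z 0 (node z N) = node z N"
    using feasible_path_length[OF fz, of 0 "node z N"] by simp
  ultimately show ?thesis
    using stage len k sum by (intro conjI exI[of _ k]) auto
qed

end
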